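(* For every $d\ge3$ there is a constant $C_2=C_2(d)$ such that, setting $M=OSH_{d-1}(n-1)$, we have $OSH_d(n)\le 2^{C_2 M\log M}$.
   Context: A set $H$ of hyperplanes in $\mathbb{R}^d$ is in general position if every $d$ members of $H$ intersect in a single point, distinct for distinct $d$-subsets. Such $H$ is one-sided if the vertex set of its arrangement (the set of all these intersection points) lies entirely on one side of the hyperplane $x_d=0$. $OSH_d(n)$ is the smallest integer $N$ such that every set of $N$ hyperplanes in $\mathbb{R}^d$ in general position contains $n$ members that are one-sided.
   Formalization: The case n = 2 is excluded, because there M = OSH_{d-1}(1) = 1 makes the bound 2^0 = 1 while OSH_d(2) = 2; n ranges over all other integers n ≥ 1, with M log M read as 0 when M = 0. *)

theory Defs
  imports Complex_Main "HOL-Library.Ramsey" "Jordan_Normal_Form.Matrix"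
begin

definition hyperplane :: "nat \<Rightarrow> real vec set \<Rightarrow> bool" where
  "hyperplane d h \<longleftrightarrow>
     (\<exists>a b. a \<in> carrier_vec d \<and> a \<noteq> 0\<^sub>v d \<and> h = {x \<in> carrier_vec d. a \<bullet> x = b})"

definition general_position :: "nat \<Rightarrow> real vec set set \<Rightarrow> bool" where
  "general_position d H \<longleftrightarrow>
     (\<forall>S. S \<subseteq> H \<and> card S = d \<longrightarrow> is_singleton (\<Inter>S)) \<and>
     inj_on Inter {S. S \<subseteq> H \<and> card S = d}"

definition vertices :: "nat \<Rightarrow> real vec set set \<Rightarrow> real vec set" where
  "vertices d H = {p. \<exists>S. S \<subseteq> H \<and> card S = d \<and> \<Inter>S = {p}}"

(* Vector entries are numbered from 0, so p $ (d - 1) is the last coordinate x_d.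
   The sides of the hyperplane x_d = 0 are the two open half-spaces. *)
definition one_sided :: "nat \<Rightarrow> real vec set set \<Rightarrow> bool" where
  "one_sided d H \<longleftrightarrow>
     (\<forall>p\<in>vertices d H. p $ (d - 1) > 0) \<or> (\<forall>p\<in>vertices d H. p $ (d - 1) < 0)"

definition OSH_property :: "nat \<Rightarrow> nat \<Rightarrow> nat \<Rightarrow> bool" where
  "OSH_property d n N \<longleftrightarrow>
     (\<forall>H. finite H \<and> card H = N \<and> (\<forall>h\<in>H. hyperplane d h) \<and> general_position d H
        \<longrightarrow> (\<exists>K. K \<subseteq> H \<and> card K = n \<and> one_sided d K))"

definition OSH :: "nat \<Rightarrow> nat \<Rightarrow> nat" where
  "OSH d n = (LEAST N. OSH_property d n N)"

lemma general_position_subset: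
  assumes "general_position d H" "K \<subseteq> H"
  shows "general_position d K"
proof -
  have "S \<subseteq> H" if "S \<subseteq> K" for S using that assms(2) by (rule subset_trans)
  then have sub: "{S. S \<subseteq> K \<and> card S = d} \<subseteq> {S. S \<subseteq> H \<and> card S = d}" by blast
  have "inj_on Inter {S. S \<subseteq> K \<and> card S = d}"
    using assms(1) inj_on_subset[OF _ sub] unfolding general_position_def by blast
  moreover have "\<forall>S. S \<subseteq> K \<and> card S = d \<longrightarrow> is_singleton (\<Inter>S)"
    using assms(1) sub unfolding general_position_def by blast
  ultimately show ?thesis unfolding general_position_def by (rule conjI[rotated])
qed

lemma vertices_mono:
  assumes "K \<subseteq> H"
  shows "vertices d K \<subseteq> vertices d H"
proof
  fix p assume "p \<in> vertices d K"
  then obtain S where "S \<subseteq> K" "card S = d" "\<Inter>S = {p}"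
    unfolding vertices_def mem_Collect_eq by (elim exE conjE) (rule that)
  moreover have "S \<subseteq> H" using \<open>S \<subseteq> K\<close> assms by (rule subset_trans)
  ultimately show "p \<in> vertices d H"
    unfolding vertices_def mem_Collect_eq by (intro exI conjI)
qed

lemma one_sided_subset: "one_sided d H \<Longrightarrow> K \<subseteq> H \<Longrightarrow> one_sided d K"
  unfolding one_sided_def using vertices_mono[of K H d] by blast

(* d + 1 hyperplanes in general position cannot have all their vertices on x_d = 0. *)
lemma vertex_off_last_coordinate_hyperplane:
  assumes d: "d \<ge> 1" and K: "card K = Suc d" and hyp: "\<forall>h\<in>K. hyperplane d h"
    and gp: "general_position d K"
  shows "\<exists>p\<in>vertices d K. p $ (d - 1) \<noteq> 0"
proof (rule ccontr)
  assume "\<not> ?thesis"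
  then have zero: "p $ (d - 1) = 0" if "p \<in> vertices d K" for p using that by blast
  have finK: "finite K" using K by (metis card.infinite nat.distinct(1))
  have "\<forall>h\<in>K. \<exists>p. \<Inter>(K - {h}) = {p}"
    using gp K finK unfolding general_position_def is_singleton_def by auto
  then obtain v where v: "\<And>h. h \<in> K \<Longrightarrow> \<Inter>(K - {h}) = {v h}" by metis
  have vz: "v h $ (d - 1) = 0" if "h \<in> K" for h
    by (rule zero) (use that v K finK in \<open>auto simp: vertices_def intro!: exI[of _ "K - {h}"]\<close>)
  have mem: "v g \<in> h" if "g \<in> K" "h \<in> K" "g \<noteq> h" for g h
    using v[OF that(1)] that by blast
  have notmem: "v h \<notin> h" if "h \<in> K" for h
  proof
    assume "v h \<in> h"
    obtain g where g: "g \<in> K" "g \<noteq> h"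
    proof -
      have "card (K - {h}) = d" using K \<open>h \<in> K\<close> by (simp add: card_Diff_singleton)
      then have "K - {h} \<noteq> {}" using d by (metis card.empty not_one_le_zero)
      then show ?thesis using that by blast
    qed
    have "v h \<in> k" if "k \<in> K" for k
      using mem[of h k] \<open>v h \<in> h\<close> \<open>h \<in> K\<close> that by blast
    then have "v h \<in> \<Inter>(K - {g})" by blast
    then have "v h = v g" using v[OF g(1)] by simp
    then have "\<Inter>(K - {h}) = \<Inter>(K - {g})" using v that g by simp
    moreover have "card (K - {h}) = d" "card (K - {g}) = d" using K finK that g by auto
    ultimately have "K - {h} = K - {g}"
      using gp unfolding general_position_def inj_on_def by blast
    then show False using g that by blast
  qed
  obtain a b where ab: "\<And>h. h \<in> K \<Longrightarrow>
      a h \<in> carrier_vec d \<and> h = {x \<in> carrier_vec d. a h \<bullet> x = b h}"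
    using hyp unfolding hyperplane_def by metis
  have inh: "x \<in> h \<longleftrightarrow> x \<in> carrier_vec d \<and> (\<Sum>k<d. a h $ k * x $ k) = b h" if "h \<in> K" for x h
  proof -
    have "x \<in> h \<longleftrightarrow> x \<in> carrier_vec d \<and> a h \<bullet> x = b h" using ab[OF that] by blast
    then show ?thesis by (auto simp: scalar_prod_def atLeast0LessThan)
  qed
  obtain h0 where h0: "h0 \<in> K" using K by fastforce
  let ?S = "K - {h0}"
  define \<delta> where "\<delta> = (\<lambda>h k. v h $ k - v h0 $ k)"
  define c where "c = (\<lambda>h. \<Sum>k<d. a h $ k * \<delta> h k)"
  define s where "s = (\<lambda>h. a h $ (d - 1) / c h)"
  define q where "q = vec d (\<lambda>k. v h0 $ k + (if k = d - 1 then 1 else 0) - (\<Sum>g\<in>?S. s g * \<delta> g k))"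
  have "card ?S = d" using K h0 by (simp add: card_Diff_singleton)
  then have ne: "?S \<noteq> {}" using d by (metis card.empty not_one_le_zero)
  have v0: "v h0 \<in> h" if "h \<in> ?S" for h using mem[of h0 h] that h0 by blast
  have vcar: "v h \<in> carrier_vec d" if h: "h \<in> K" for h
  proof -
    obtain g where "g \<in> K" "g \<noteq> h" using ne h0 h by (cases "h = h0") auto
    then show ?thesis using mem[of h g] inh[of g "v h"] h by blast
  qed
  have off: "(\<Sum>k<d. a h $ k * \<delta> g k) = 0" if "h \<in> ?S" "g \<in> ?S" "g \<noteq> h" for g h
    using inh[of h "v g"] inh[of h "v h0"] mem[of g h] v0[of h] that
    by (auto simp: \<delta>_def right_diff_distrib sum_subtractf)
  have c0: "c h \<noteq> 0" if "h \<in> ?S" for h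
    using inh[of h "v h"] inh[of h "v h0"] notmem[of h] v0[of h] vcar[of h] that
    by (auto simp: c_def \<delta>_def right_diff_distrib sum_subtractf)
  have "q \<in> h" if h: "h \<in> ?S" for h
  proof -
    have "(\<Sum>k<d. a h $ k * q $ k)
        = (\<Sum>k<d. a h $ k * v h0 $ k + (if k = d - 1 then a h $ k else 0)
             - (\<Sum>g\<in>?S. s g * (a h $ k * \<delta> g k)))"
      by (rule sum.cong) (auto simp: q_def algebra_simps sum_distrib_left)
    also have "\<dots> = (\<Sum>k<d. a h $ k * v h0 $ k) + a h $ (d - 1)
        - (\<Sum>k<d. \<Sum>g\<in>?S. s g * (a h $ k * \<delta> g k))"
      using d by (simp add: sum.distrib sum_subtractf)
    also have "(\<Sum>k<d. \<Sum>g\<in>?S. s g * (a h $ k * \<delta> g k))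
        = (\<Sum>g\<in>?S. s g * (\<Sum>k<d. a h $ k * \<delta> g k))"
      by (subst sum.swap) (simp add: sum_distrib_left)
    also have "\<dots> = (\<Sum>g\<in>?S. if g = h then a h $ (d - 1) else 0)"
      using off[OF h] c0[OF h] by (intro sum.cong) (auto simp: s_def c_def)
    also have "\<dots> = a h $ (d - 1)" using h finK by simp
    also have "(\<Sum>k<d. a h $ k * v h0 $ k) = b h" using inh[of h "v h0"] v0[OF h] h by blast
    finally show ?thesis using inh[of h q] h by (simp add: q_def)
  qed
  then have "q \<in> \<Inter>?S" by blast
  then have "q = v h0" using v[OF h0] by simp
  moreover have "q $ (d - 1) = 1"
    using d vz h0 by (simp add: q_def \<delta>_def)
  ultimately show False using vz[OF h0] by simp
qed

lemma OSH_property_exists: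
  assumes d: "d \<ge> 1"
  shows "\<exists>N. OSH_property d n N"
proof -
  define m where "m = max n (Suc d)"
  obtain N :: nat where N: "partn_lst {..<N} [m, m, m] d"
    using ramsey_full by blast
  have "OSH_property d n N"
    unfolding OSH_property_def
  proof (intro allI impI, elim conjE)
    fix H :: "real vec set set"
    assume H: "finite H" "card H = N" "\<forall>h\<in>H. hyperplane d h" and gp: "general_position d H"
    obtain e where e: "bij_betw e {..<N} H"
      using H(1,2) by (metis bij_betw_from_nat_into_finite)
    define x where "x = (\<lambda>T. the_elem (\<Inter>(e ` T)) $ (d - 1))"
    define f :: "nat set \<Rightarrow> nat" where
      "f = (\<lambda>T. if x T > 0 then 0 else if x T < 0 then 1 else 2)"
    have "f \<in> nsets {..<N} d \<rightarrow> {..<3}" by (auto simp: f_def)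
    then obtain i I where i: "i < length [m, m, m]" and I: "I \<in> nsets {..<N} ([m, m, m] ! i)"
      and mono: "f ` nsets I d \<subseteq> {i}"
      by (rule partn_lstE[OF N]) auto
    have cases_i: "i = 0 \<or> i = 1 \<or> i = 2" using i by auto
    then have I': "I \<subseteq> {..<N}" "finite I" "card I = m"
      using I by (auto simp: nsets_def)
    have inj: "inj_on e I" using e I'(1) by (meson bij_betw_def inj_on_subset)
    define K where "K = e ` I"
    have K: "K \<subseteq> H" "card K = m"
      using bij_betw_imp_surj_on[OF e] I' card_image[OF inj] unfolding K_def by blast+
    have sign: "\<exists>T \<in> nsets I d. p $ (d - 1) = x T" if p: "p \<in> vertices d K" for p
    proof -
      obtain S where S: "S \<subseteq> K" "card S = d" "\<Inter>S = {p}"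
        using p[unfolded vertices_def mem_Collect_eq] by (elim exE conjE) (rule that)
      obtain T where T: "T \<subseteq> I" "S = e ` T" using S(1) unfolding K_def by (meson subset_imageE)
      have "card T = d" using card_image[OF inj_on_subset[OF inj T(1)]] T(2) S(2) by simp
      then have "T \<in> nsets I d"
        using T(1) finite_subset[OF T(1) I'(2)] by (simp add: nsets_def)
      moreover have "p $ (d - 1) = x T" using S(3) by (simp add: x_def flip: T(2))
      ultimately show ?thesis by (rule bexI[rotated])
    qed
    have fi: "f T = i" if "T \<in> nsets I d" for T using mono that by blast
    have "i \<noteq> 2"
    proof
      assume "i = 2"
      obtain K' where K': "K' \<subseteq> K" "card K' = Suc d"
        using K(2) unfolding m_def by (metis max.cobounded2 obtain_subset_with_card_n)
      obtain p where p: "p \<in> vertices d K'" "p $ (d - 1) \<noteq> 0"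
      proof -
        have "K' \<subseteq> H" using K'(1) K(1) by (rule subset_trans)
        then have "\<forall>h\<in>K'. hyperplane d h" "general_position d K'"
          using H(3) general_position_subset[OF gp] by auto
        then show ?thesis
          using vertex_off_last_coordinate_hyperplane[OF d K'(2)] that by blast
      qed
      then have "p \<in> vertices d K" using vertices_mono[OF K'(1)] by blast
      then obtain T where "T \<in> nsets I d" "p $ (d - 1) = x T" using sign by blast
      then show False
        using fi[of T] p(2) \<open>i = 2\<close> by (simp add: f_def split: if_splits)
    qed
    with cases_i have "one_sided d K"
    proof (elim disjE)
      assume "i = 0"
      then have "p $ (d - 1) > 0" if "p \<in> vertices d K" for p
        using sign[OF that] fi by (fastforce simp: f_def split: if_splits)
      then show ?thesis by (auto simp: one_sided_def)
    next
      assume "i = 1"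
      then have "p $ (d - 1) < 0" if "p \<in> vertices d K" for p
        using sign[OF that] fi by (fastforce simp: f_def split: if_splits)
      then show ?thesis by (auto simp: one_sided_def)
    qed simp
    moreover obtain K'' where "K'' \<subseteq> K" "card K'' = n"
      using K(2) unfolding m_def by (metis max.cobounded1 obtain_subset_with_card_n)
    ultimately have "K'' \<subseteq> H \<and> card K'' = n \<and> one_sided d K''"
      using K(1) one_sided_subset[of d K K''] by blast
    then show "\<exists>K. K \<subseteq> H \<and> card K = n \<and> one_sided d K" by (rule exI)
  qed
  then show ?thesis ..
qed

lemma OSH_property_OSH: "d \<ge> 1 \<Longrightarrow> OSH_property d n (OSH d n)"
  unfolding OSH_def using OSH_property_exists by (rule LeastI_ex)

(* Fewer than d hyperplanes have no vertices. In particular OSH d 2 = 2 and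
   OSH (d - 1) 1 = 1 for d at least 3. *)
lemma OSH_below_dim:
  assumes "n < d"
  shows "OSH d n = n"
  unfolding OSH_def
proof (rule Least_equality)
  have "one_sided d H" if "finite H" "card H = n" for H
  proof -
    have "card S \<noteq> d" if "S \<subseteq> H" for S
      using card_mono[OF \<open>finite H\<close> that] \<open>card H = n\<close> assms by linarith
    then have "vertices d H = {}" unfolding vertices_def by blast
    then show ?thesis by (simp add: one_sided_def)
  qed
  then show "OSH_property d n n" unfolding OSH_property_def by blast
next
  fix N assume N: "OSH_property d n N"
  show "n \<le> N"
  proof (rule ccontr)
    assume "\<not> n \<le> N"
    define h where "h = (\<lambda>i::nat. {x \<in> carrier_vec d. unit_vec d 0 \<bullet> x = real i})"
    have hyp: "hyperplane d (h i)" for i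
      unfolding hyperplane_def h_def
      using assms by (intro exI[of _ "unit_vec d 0"] exI[of _ "real i"]) auto
    have "inj h"
    proof (rule injI)
      fix i j assume "h i = h j"
      moreover have "vec d (\<lambda>_. real i) \<in> h i" using assms by (simp add: h_def)
      ultimately have "vec d (\<lambda>_. real i) \<in> h j" by simp
      then show "i = j" using assms by (simp add: h_def)
    qed
    then have card: "card (h ` {..<N}) = N"
      by (metis card_image card_lessThan inj_on_subset subset_UNIV)
    have no: "\<not> (S \<subseteq> h ` {..<N} \<and> card S = d)" for S
    proof
      assume "S \<subseteq> h ` {..<N} \<and> card S = d"
      then have "d \<le> N" using card card_mono[of "h ` {..<N}" S] by simp
      then show False using \<open>\<not> n \<le> N\<close> assms by linarith
    qed
    have "general_position d (h ` {..<N})"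
      using no unfolding general_position_def inj_on_def by blast
    then obtain K where K: "K \<subseteq> h ` {..<N}" "card K = n"
      using N[unfolded OSH_property_def, rule_format, of "h ` {..<N}"] card hyp by blast
    then have "n \<le> N" using card card_mono[OF _ K(1)] by simp
    then show False using \<open>\<not> n \<le> N\<close> by simp
  qed
qed

end

theory Submission
  imports Defs
begin

text \<open>
  By Cramer's rule, the sign of the last coordinate of a vertex on a fixed line, as a function of
  the last hyperplane through it, is a product of the signs of two linear forms in the \<open>d + 1\<close>
  coefficients of that hyperplane. A family of \<open>t\<close> linear forms in \<open>D\<close> variables has at most
  \<open>(2t + 1)^D\<close> sign vectors, so in the Erdos-Rado greedy argument each of the \<open>M\<close> steps costs only
  a factor polynomial in \<open>M\<close>. This yields \<open>M\<close> hyperplanes and a further one \<open>x\<close>, such that the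
  sign of any vertex equals the sign of a vertex on \<open>x\<close>. The traces of the \<open>M\<close>
  hyperplanes on \<open>x\<close> form an arrangement in dimension \<open>d - 1\<close>, which contains \<open>n - 1\<close> one-sided
  members; together with \<open>x\<close> they are one-sided in dimension \<open>d\<close>. A hyperplane parallel to
  \<open>x_d = 0\<close> would break the reduction, but general position allows at most one of these.
\<close>

section \<open>Sign vectors of finite families of linear forms\<close>

text \<open>Restricting to \<open>A\<close> makes the patterns extensional, so that there are
  finitely many of them and cardinality counts patterns that differ on \<open>A\<close>.\<close>

definition sign_vectors :: "'a set \<Rightarrow> 'i set \<Rightarrow> ('a \<Rightarrow> 'i \<Rightarrow> real) \<Rightarrow> ('a \<Rightarrow> real) set" where
  "sign_vectors A I L = range (\<lambda>y. restrict (\<lambda>a. sgn (\<Sum>i\<in>I. L a i * y i)) A)"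

lemma finite_sign_vectors:
  assumes "finite A"
  shows "finite (sign_vectors A I L)"
proof (rule finite_subset)
  have "sgn x \<in> {-1, 0, 1}" for x :: real
    by (simp add: sgn_if)
  then show "sign_vectors A I L \<subseteq> A \<rightarrow>\<^sub>E {-1, 0, 1}"
    unfolding sign_vectors_def by (intro image_subsetI) (simp only: restrict_PiE_iff, blast)
  show "finite (A \<rightarrow>\<^sub>E {-1, 0, 1::real})"
    using assms by (simp add: finite_PiE)
qed

text \<open>Induction on the forms. A pattern on \<open>A\<close> may extend to \<open>a\<close> in
  several ways, but one that extends by both 1 and -1 also extends by 0, and the patterns that
  extend by 0 come from the kernel of the form \<open>a\<close>, so from one variable fewer. For a
  nonzero form this gives f(t+1, D) \<le> f(t, D) + 2 f(t, D-1) for t forms in D variables, and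
  (2t+1)^D is large enough for this recurrence.\<close>

lemma card_sign_vectors:
  assumes "finite A" "finite I"
  shows "card (sign_vectors A I L) \<le> (2 * card A + 1) ^ card I"
  using assms
proof (induction A arbitrary: I L rule: finite_induct)
  case empty
  have "sign_vectors {} I L = {\<lambda>_. undefined}"
    by (simp add: sign_vectors_def restrict_def)
  then show ?case by simp
next
  case (insert a A)
  define form where "form = (\<lambda>b y. \<Sum>i\<in>I. L b i * y i)"
  define \<sigma> where "\<sigma> = (\<lambda>B y. restrict (\<lambda>b. sgn (form b y)) B)"
  have SV: "sign_vectors B I L = range (\<sigma> B)" for B
    by (simp add: sign_vectors_def \<sigma>_def form_def)
  define R where "R = (\<lambda>s. \<sigma> A ` {y. sgn (form a y) = s})"
  have sgn_cases: "sgn x = -1 \<or> sgn x = 0 \<or> sgn x = 1" for x :: real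
    by (auto simp: sgn_if)
  have ext: "\<sigma> (insert a A) y = (\<sigma> A y)(a := sgn (form a y))" for y
    using insert.hyps by (auto simp: \<sigma>_def fun_eq_iff)
  have "sign_vectors (insert a A) I L \<subseteq>
      (\<lambda>v. v(a := 0)) ` R 0 \<union> (\<lambda>v. v(a := 1)) ` R 1 \<union> (\<lambda>v. v(a := -1)) ` R (-1)"
    unfolding SV R_def using sgn_cases by (fastforce simp: ext)
  moreover have R_sub: "R s \<subseteq> sign_vectors A I L" for s
    unfolding SV R_def by blast
  then have fin: "finite (R s)" for s
    using finite_sign_vectors[OF insert.hyps(1)] finite_subset by blast
  ultimately have "card (sign_vectors (insert a A) I L) \<le>
      card ((\<lambda>v. v(a := 0)) ` R 0 \<union> (\<lambda>v. v(a := 1)) ` R 1 \<union> (\<lambda>v. v(a := -1)) ` R (-1))"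
    by (intro card_mono) auto
  also have "\<dots> \<le> card (R 0) + card (R 1) + card (R (-1))"
    by (intro order_trans[OF card_Un_le] add_mono card_image_le fin)
  finally have le: "card (sign_vectors (insert a A) I L) \<le> card (R 0) + card (R 1) + card (R (-1))" .
  show ?case
  proof (cases "\<exists>j\<in>I. L a j \<noteq> 0")
    case False
    then have "form a y = 0" for y by (simp add: form_def)
    then have "R 1 = {}" "R (-1) = {}" by (auto simp: R_def)
    then have "card (sign_vectors (insert a A) I L) \<le> card (sign_vectors A I L)"
      using le card_mono[OF finite_sign_vectors[OF insert.hyps(1)] R_sub[of 0]] by simp
    also have "\<dots> \<le> (2 * card A + 1) ^ card I" by (rule insert.IH) fact
    also have "\<dots> \<le> (2 * card (insert a A) + 1) ^ card I"
      using insert.hyps by (intro power_mono) auto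
    finally show ?thesis .
  next
    case True
    then obtain j where j: "j \<in> I" "L a j \<noteq> 0" by blast
    \<comment> \<open>Solving \<open>form a y = 0\<close> for \<open>y j\<close> and substituting
      turns \<open>form b\<close> into a form with coefficients \<open>L' b\<close> in the variables
      \<open>I - {j}\<close>.\<close>
    define L' where "L' = (\<lambda>b i. L b i - L b j * L a i / L a j)"
    have elim: "form b y = (\<Sum>i\<in>I - {j}. L' b i * y i)" if "form a y = 0" for b y
    proof -
      have "y j = - (\<Sum>i\<in>I - {j}. L a i * y i) / L a j"
        using that j insert.prems by (simp add: form_def sum.remove field_simps)
      then have "form b y = (\<Sum>i\<in>I - {j}. L b i * y i) - L b j * (\<Sum>i\<in>I - {j}. L a i * y i) / L a j"
        using j insert.prems by (simp add: form_def sum.remove)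
      then show ?thesis
        by (simp add: L'_def left_diff_distrib sum_subtractf sum_distrib_left sum_divide_distrib mult.assoc)
    qed
    have "R 0 \<subseteq> sign_vectors A (I - {j}) L'"
      unfolding R_def sign_vectors_def \<sigma>_def by (auto simp: elim sgn_0_0)
    then have "card (R 0) \<le> card (sign_vectors A (I - {j}) L')"
      by (intro card_mono finite_sign_vectors insert.hyps)
    also have "\<dots> \<le> (2 * card A + 1) ^ card (I - {j})"
      using insert.prems by (intro insert.IH) simp
    finally have R0: "card (R 0) \<le> (2 * card A + 1) ^ (card I - 1)"
      using j insert.prems by simp
    \<comment> \<open>A positive combination of points on the two sides of the hyperplane lies on it
      and keeps all signs on which the two points agree.\<close>
    have "R 1 \<inter> R (-1) \<subseteq> R 0"
    proof
      fix v assume "v \<in> R 1 \<inter> R (-1)"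
      then obtain x y where x: "form a x > 0" "v = \<sigma> A x" and y: "form a y < 0" "v = \<sigma> A y"
        by (auto simp: R_def sgn_1_pos sgn_1_neg)
      define z where "z = (\<lambda>i. form a x * y i + (- form a y) * x i)"
      have form_z: "form b z = form a x * form b y + (- form a y) * form b x" for b
      proof -
        have "(\<Sum>i\<in>I. L b i * (p * y i + q * x i)) = p * form b y + q * form b x" for p q
          by (simp add: form_def algebra_simps sum.distrib sum_distrib_left)
        then show ?thesis unfolding z_def form_def .
      qed
      have "sgn (form b z) = sgn (form b x)" if "b \<in> A" for b
      proof -
        have "sgn (form b x) = sgn (form b y)"
          using x(2) y(2) that unfolding \<sigma>_def by (metis restrict_apply')
        then consider "form b x = 0" "form b y = 0" | "form b x > 0" "form b y > 0"
          | "form b x < 0" "form b y < 0"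
          by (metis sgn_1_neg sgn_1_pos sgn_0_0 sgn_cases)
        then show ?thesis
        proof cases
          case 2
          then have "form b z > 0" using x(1) y(1) unfolding form_z
            by (intro add_pos_pos mult_pos_pos) auto
          then show ?thesis using 2 by simp
        next
          case 3
          then have "form b z < 0" using x(1) y(1) unfolding form_z
            by (intro add_neg_neg mult_pos_neg) auto
          then show ?thesis using 3 by simp
        qed (simp add: form_z)
      qed
      then have "\<sigma> A z = v" unfolding x(2) \<sigma>_def by (rule restrict_ext)
      moreover have "form a z = 0" by (simp add: form_z)
      ultimately show "v \<in> R 0" by (auto simp: R_def)
    qed
    have "card (R 1) + card (R (-1)) = card (R 1 \<union> R (-1)) + card (R 1 \<inter> R (-1))"
      by (rule card_Un_Int[OF fin fin])
    also have "\<dots> \<le> card (sign_vectors A I L) + card (R 0)"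
      using R_sub \<open>R 1 \<inter> R (-1) \<subseteq> R 0\<close>
      by (intro add_mono card_mono finite_sign_vectors insert.hyps fin) auto
    finally have "card (sign_vectors (insert a A) I L) \<le> card (sign_vectors A I L) + 2 * card (R 0)"
      using le by simp
    also have "\<dots> \<le> (2 * card A + 1) ^ card I + 2 * (2 * card A + 1) ^ (card I - 1)"
      using R0 insert.IH[OF insert.prems] by (intro add_mono) auto
    also have "\<dots> = (2 * card A + 1) ^ (card I - 1) * (2 * card A + 3)"
      using j insert.prems by (cases "card I") (auto simp: algebra_simps)
    also have "\<dots> \<le> (2 * card A + 3) ^ (card I - 1) * (2 * card A + 3)"
      by (intro mult_right_mono power_mono) auto
    also have "\<dots> = (2 * card A + 3) ^ card I"
      using j insert.prems by (cases "card I") auto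
    also have "2 * card A + 3 = 2 * card (insert a A) + 1"
      using insert.hyps by simp
    finally show ?thesis .
  qed
qed

section \<open>The greedy Erdos-Rado argument\<close>

text \<open>\<open>G\<close> grows one point at a time beside a reservoir \<open>R\<close> of points
  that all colour the \<open>k\<close>-subsets of \<open>G\<close> alike. Each step moves some
  \<open>x\<close> from \<open>R\<close> to \<open>G\<close> and shrinks the rest of
  \<open>R\<close> to its largest colour class; there are at most \<open>Q\<close> classes, so
  \<open>R\<close> loses a factor of at most \<open>Q + 1\<close>. In a set \<open>S\<close> of
  chosen points, the one chosen last can then be exchanged for any point of the final
  reservoir.\<close>

lemma end_homogeneous_exists:
  fixes col :: "'a set \<Rightarrow> 'b"
  assumes fin: "finite H" and card_H: "(Q + 1) ^ M \<le> card H" and k: "k > 0" and Q: "Q > 0"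
    and classes: "\<And>G R. G \<subseteq> H \<Longrightarrow> card G \<le> M \<Longrightarrow> R \<subseteq> H - G \<Longrightarrow>
      card ((\<lambda>x. restrict (\<lambda>T. col (insert x T)) {T. T \<subseteq> G \<and> card T = k}) ` R) \<le> Q"
  shows "\<exists>G x. G \<subseteq> H \<and> card G = M \<and> x \<in> H - G \<and>
    (\<forall>S\<subseteq>G. card S = Suc k \<longrightarrow> (\<exists>s\<in>S. col S = col (insert x (S - {s}))))"
proof -
  \<comment> \<open>The exchange property is required for all reservoir points at once, so it
    survives every later shrinking of \<open>R\<close>.\<close>
  define Inv where "Inv = (\<lambda>G R.
      (\<forall>S\<subseteq>G. card S = Suc k \<longrightarrow> (\<exists>s\<in>S. \<forall>x\<in>R. col S = col (insert x (S - {s})))) \<and>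
      (\<forall>T\<subseteq>G. card T = k \<longrightarrow> (\<forall>x\<in>R. \<forall>y\<in>R. col (insert x T) = col (insert y T))))"
  have "\<exists>G R. G \<subseteq> H \<and> R \<subseteq> H - G \<and> card G = m \<and> (Q + 1) ^ (M - m) \<le> card R \<and> Inv G R"
    if "m \<le> M" for m
    using that
  proof (induction m)
    case 0
    have "Inv {} H" using k by (simp add: Inv_def)
    then show ?case using card_H by (intro exI[of _ "{}"] exI[of _ H]) simp
  next
    case (Suc m)
    from Suc.prems have "m \<le> M" by simp
    from Suc.IH[OF this] obtain G R where G: "G \<subseteq> H" "card G = m"
      and R: "R \<subseteq> H - G" "(Q + 1) ^ (M - m) \<le> card R" and Inv: "Inv G R"
      by blast
    have old: "\<exists>s\<in>S. \<forall>x\<in>R. col S = col (insert x (S - {s}))" if "S \<subseteq> G" "card S = Suc k" for S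
      using Inv that unfolding Inv_def by blast
    have hom: "col (insert x T) = col (insert y T)"
      if "T \<subseteq> G" "card T = k" "x \<in> R" "y \<in> R" for T x y
      using Inv that unfolding Inv_def by blast
    have finG: "finite G" and finR: "finite R"
      using G(1) R(1) fin by (meson Diff_subset finite_subset)+
    define q where "q = (Q + 1) ^ (M - Suc m)"
    have q: "q \<ge> 1" "(Q + 1) * q \<le> card R"
      using R(2) Suc.prems by (auto simp: q_def Suc_diff_Suc simp flip: power_Suc)
    then have "card R > 0" by (cases "card R") auto
    then obtain x where x: "x \<in> R" by (auto simp: card_gt_0_iff)
    define G' where "G' = insert x G"
    define f where "f = (\<lambda>y. restrict (\<lambda>T. col (insert y T)) {T. T \<subseteq> G' \<and> card T = k})"
    have x': "x \<notin> G" "x \<in> H" using x R by auto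
    have G': "G' \<subseteq> H" "card G' = Suc m"
      using G x' finG by (auto simp: G'_def)
    have classes': "card (f ` (R - {x})) \<le> Q"
      unfolding f_def using G' Suc.prems R by (intro classes) (auto simp: G'_def)
    obtain R' where R': "R' \<subseteq> R - {x}" "q \<le> card R'" and f: "\<And>y z. y \<in> R' \<Longrightarrow> z \<in> R' \<Longrightarrow> f y = f z"
    proof -
      have "2 * 1 \<le> (Q + 1) * q" using Q q(1) by (intro mult_le_mono) auto
      then have "card (R - {x}) \<noteq> 0" using q(2) x finR by (simp add: card_Diff_singleton)
      then have "R - {x} \<noteq> {}" by (metis card.empty)
      then obtain c where c: "card (R - {x}) \<le> card (f -` {c} \<inter> (R - {x})) * card (f ` (R - {x}))"
        using pigeonhole_card[of f "R - {x}" "f ` (R - {x})"] finR by auto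
      let ?R = "f -` {c} \<inter> (R - {x})"
      \<comment> \<open>The factor \<open>Q + 1\<close> instead of \<open>Q\<close> pays for the
        removal of \<open>x\<close>: at least (Q+1)q - 1 points cannot be split into at most
        \<open>Q\<close> classes of size below \<open>q\<close>.\<close>
      have "q \<le> card ?R"
      proof (rule ccontr)
        assume "\<not> ?thesis"
        then have "card ?R + 1 \<le> q" by simp
        have "(Q + 1) * q \<le> card (R - {x}) + 1"
          using q(2) x finR by (simp add: card_Diff_singleton)
        also have "\<dots> \<le> card ?R * Q + 1"
          using c classes' by (meson add_le_mono1 mult_le_mono2 order_trans)
        also have "\<dots> < (card ?R + 1) * Q + 1" using Q by simp
        also have "\<dots> \<le> q * Q + q"
          using \<open>card ?R + 1 \<le> q\<close> by (intro add_mono mult_right_mono) auto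
        finally show False by (simp add: algebra_simps)
      qed
      then show ?thesis by (intro that[of ?R]) auto
    qed
    have "\<exists>s\<in>S. \<forall>y\<in>R'. col S = col (insert y (S - {s}))"
      if S: "S \<subseteq> G'" "card S = Suc k" for S
    \<comment> \<open>If \<open>x\<close> belongs to \<open>S\<close>, it is the point chosen last
      and the one to exchange; otherwise \<open>S\<close> was settled earlier.\<close>
    proof (cases "x \<in> S")
      case True
      have "S - {x} \<subseteq> G" using S by (auto simp: G'_def)
      moreover have "card (S - {x}) = k" using S True by simp
      ultimately have "col (insert x (S - {x})) = col (insert y (S - {x}))" if "y \<in> R'" for y
        using hom x that R' by blast
      then have "\<forall>y\<in>R'. col S = col (insert y (S - {x}))"
        unfolding insert_Diff[OF True] by (rule ballI)
      then show ?thesis using True by (rule bexI)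
    next
      case False
      then have "S \<subseteq> G" using S by (auto simp: G'_def)
      then obtain s where "s \<in> S" "\<forall>y\<in>R. col S = col (insert y (S - {s}))"
        using old[OF _ S(2)] by blast
      then show ?thesis using R'(1) by blast
    qed
    moreover have "col (insert y T) = col (insert z T)"
      if "T \<subseteq> G'" "card T = k" "y \<in> R'" "z \<in> R'" for T y z
      using f[OF that(3,4)] that(1,2) unfolding f_def by (metis (mono_tags, lifting) mem_Collect_eq restrict_apply')
    ultimately have "Inv G' R'" unfolding Inv_def by (intro conjI allI impI ballI)
    moreover have "R' \<subseteq> H - G'" using R' R by (auto simp: G'_def)
    ultimately show ?case
      using G' R'(2) unfolding q_def by blast
  qed
  from this[of M] obtain G R where G: "G \<subseteq> H" "card G = M" "R \<subseteq> H - G" "1 \<le> card R" and Inv: "Inv G R"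
    by auto
  from G(4) obtain x where "x \<in> R" by (metis card.empty equals0I not_one_le_zero)
  then have "\<forall>S\<subseteq>G. card S = Suc k \<longrightarrow> (\<exists>s\<in>S. col S = col (insert x (S - {s})))"
    using Inv unfolding Inv_def by meson
  then show ?thesis using G \<open>x \<in> R\<close> by blast
qed

section \<open>General position and the signs of vertices\<close>

text \<open>Otherwise, in a \<open>d\<close>-set containing \<open>h1\<close> and \<open>h2\<close>
  but not \<open>g\<close>, replacing \<open>h1\<close> by \<open>g\<close> would not move the
  vertex, although vertices of different \<open>d\<close>-sets differ. This will show that traces on
  a hyperplane are distinct and are proper hyperplanes there.\<close>

lemma two_hyperplanes_not_subset:
  assumes gp: "general_position d H" and fin: "finite H" and d: "d \<ge> 2" "card H \<ge> Suc d"
    and H: "h1 \<in> H" "h2 \<in> H" "g \<in> H" and ne: "h1 \<noteq> h2" "g \<noteq> h1" "g \<noteq> h2"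
  shows "\<not> h1 \<inter> h2 \<subseteq> g"
proof
  assume sub: "h1 \<inter> h2 \<subseteq> g"
  have "{h1, h2} \<subseteq> H - {g}" using H ne by blast
  moreover have "card {h1, h2} \<le> d" "d \<le> card (H - {g})"
    using H(3) ne(1) d fin by (simp_all add: card_Diff_singleton)
  ultimately obtain S where S: "{h1, h2} \<subseteq> S" "S \<subseteq> H - {g}" "card S = d"
    using exists_subset_between[of "{h1, h2}" d "H - {g}"] fin by blast
  have finS: "finite S" using S(2) fin by (meson finite_Diff finite_subset)
  have ex1: "\<exists>p. \<Inter>S' = {p}" if "S' \<subseteq> H" "card S' = d" for S'
    using gp that unfolding general_position_def is_singleton_def by blast
  define S' where "S' = insert g (S - {h1})"
  have "g \<notin> S - {h1}" "h1 \<in> S" using S by auto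
  then have "card S' = d"
    using S(3) finS d by (simp add: S'_def)
  moreover have "S' \<subseteq> H" using S(2) H by (auto simp: S'_def)
  ultimately have S': "S' \<subseteq> H" "card S' = d" by simp_all
  have SH: "S \<subseteq> H" using S by blast
  obtain p where p: "\<Inter>S = {p}" using ex1[OF SH S(3)] by blast
  obtain q where q: "\<Inter>S' = {q}" using ex1[OF S'] by blast
  have "p \<in> h" if "h \<in> S" for h using p that by blast
  then have "p \<in> \<Inter>S'" using sub S(1) unfolding S'_def by blast
  then have "\<Inter>S = \<Inter>S'" unfolding p q by simp
  moreover have "inj_on Inter {S. S \<subseteq> H \<and> card S = d}"
    using gp unfolding general_position_def by blast
  ultimately have "S = S'" using SH S(3) S' by (simp add: inj_on_def)
  moreover have "g \<in> S'" by (simp add: S'_def)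
  ultimately show False using S(2) by blast
qed

text \<open>\<open>the_elem\<close> is meaningful only for singletons, which general position
  guarantees for \<open>d\<close>-subsets. The value 0 marks a vertex on the hyperplane
  \<open>x_d = 0\<close>.\<close>

definition vertex_sign :: "nat \<Rightarrow> real vec set set \<Rightarrow> real" where
  "vertex_sign d S = sgn (the_elem (\<Inter>S) $ (d - 1))"

text \<open>An equation is determined by its hyperplane only up to scaling, so one is fixed for each
  member. With at least \<open>d + 1\<close> members, every line cut out by \<open>d - 1\<close> of
  them carries two vertices.\<close>

locale arrangement =
  fixes d :: nat and H :: "real vec set set"
    and nrm :: "real vec set \<Rightarrow> real vec" and off :: "real vec set \<Rightarrow> real"
  assumes dim: "d \<ge> 2" and fin: "finite H" and card_H: "card H \<ge> Suc d"
    and gp: "general_position d H"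
    and nrm: "h \<in> H \<Longrightarrow> nrm h \<in> carrier_vec d" "h \<in> H \<Longrightarrow> nrm h \<noteq> 0\<^sub>v d"
    and hyp_eq: "h \<in> H \<Longrightarrow> h = {x \<in> carrier_vec d. nrm h \<bullet> x = off h}"
begin

lemma mem_iff: "h \<in> H \<Longrightarrow> x \<in> h \<longleftrightarrow> x \<in> carrier_vec d \<and> nrm h \<bullet> x = off h"
  using hyp_eq[of h] by blast

lemma vertex_ex:
  assumes "S \<subseteq> H" "card S = d"
  obtains p where "\<Inter>S = {p}" "p \<in> carrier_vec d" "\<And>h. h \<in> S \<Longrightarrow> nrm h \<bullet> p = off h"
    "vertex_sign d S = sgn (p $ (d - 1))"
proof -
  obtain p where p: "\<Inter>S = {p}"
    using gp assms unfolding general_position_def is_singleton_def by blast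
  have "S \<noteq> {}" using assms(2) dim by auto
  then have "p \<in> carrier_vec d" "\<And>h. h \<in> S \<Longrightarrow> nrm h \<bullet> p = off h"
    using p assms(1) mem_iff by blast+
  with p show ?thesis by (intro that[of p]) (auto simp: vertex_sign_def)
qed

lemma vertex_unique:
  assumes "S \<subseteq> H" "card S = d" "\<Inter>S = {p}" "x \<in> carrier_vec d" "\<And>h. h \<in> S \<Longrightarrow> nrm h \<bullet> x = off h"
  shows "x = p"
proof -
  have "x \<in> \<Inter>S" using assms mem_iff by blast
  then show ?thesis using assms(3) by blast
qed

lemma vertices_distinct:
  assumes "S \<subseteq> H" "card S = d" "S' \<subseteq> H" "card S' = d" "\<Inter>S = \<Inter>S'"
  shows "S = S'"
proof (rule inj_onD)
  show "inj_on Inter {S. S \<subseteq> H \<and> card S = d}"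
    using gp by (simp add: general_position_def)
qed (use assms in auto)

text \<open>The variables of the linear forms whose signs are counted; the offset has index
  \<open>d\<close>.\<close>

definition coords :: "real vec set \<Rightarrow> nat \<Rightarrow> real" where
  "coords h i = (if i < d then nrm h $ i else off h)"

text \<open>
  Two vertices on the line \<open>\<Inter>T\<close> give a base point and a direction of it. Cramer's rule for the
  intersection with a further hyperplane \<open>h\<close> writes the last coordinate as a quotient of two
  forms which are linear in the equation of \<open>h\<close>.
\<close>

lemma vertex_sign_linear:
  assumes T: "T \<subseteq> H" "card T = d - 1"
  obtains L1 L2 :: "nat \<Rightarrow> real" where
    "\<And>h. h \<in> H - T \<Longrightarrow> vertex_sign d (insert h T)
       = sgn (\<Sum>i<Suc d. L1 i * coords h i) * sgn (\<Sum>i<Suc d. L2 i * coords h i)"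
proof -
  have finT: "finite T" using T fin finite_subset by blast
  have ins: "insert h T \<subseteq> H" "card (insert h T) = d" if "h \<in> H - T" for h
    using that T finT dim by auto
  have "card (H - T) \<ge> 2"
    using card_H T finT dim by (simp add: card_Diff_subset)
  then obtain B where "B \<subseteq> H - T" "card B = 2"
    by (rule obtain_subset_with_card_n)
  then obtain h0 h1 where h01: "h0 \<in> H - T" "h1 \<in> H - T" "h0 \<noteq> h1"
    unfolding card_2_iff by blast
  obtain p where p: "\<Inter>(insert h0 T) = {p}" "p \<in> carrier_vec d" "\<And>h. h \<in> insert h0 T \<Longrightarrow> nrm h \<bullet> p = off h"
    using vertex_ex[OF ins[OF h01(1)]] by metis
  obtain q where q: "\<Inter>(insert h1 T) = {q}" "q \<in> carrier_vec d" "\<And>h. h \<in> insert h1 T \<Longrightarrow> nrm h \<bullet> q = off h"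
    using vertex_ex[OF ins[OF h01(2)]] by metis
  have "p \<noteq> q"
  proof
    assume "p = q"
    then have "insert h0 T = insert h1 T"
      using vertices_distinct[OF ins[OF h01(1)] ins[OF h01(2)]] p(1) q(1) by simp
    then show False using h01 by blast
  qed
  define v where "v = q - p"
  have v: "v \<in> carrier_vec d" using p q by (simp add: v_def)
  have nrm_v: "nrm t \<bullet> v = 0" if "t \<in> T" for t
    using p q that nrm(1)[of t] T by (auto simp: v_def scalar_prod_minus_distrib)
  have line: "nrm h \<bullet> (x + s \<cdot>\<^sub>v v) = nrm h \<bullet> x + s * (nrm h \<bullet> v)"
    if "h \<in> H" "x \<in> carrier_vec d" for h x s
    using nrm(1)[OF that(1)] that(2) v by (simp add: scalar_prod_add_distrib[of _ d])
  \<comment> \<open>The line meets \<open>h\<close> at \<open>p\<close> plus \<open>s\<close> times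
    \<open>v\<close>, with \<open>s = (off h - nrm h \<bullet> p) / (nrm h \<bullet> v)\<close>.
    Over the common denominator, the last coordinate of this point has a numerator with coefficients
    \<open>L1\<close> and a denominator with coefficients \<open>L2\<close>.\<close>
  define L1 where "L1 = (\<lambda>i. if i < d then p $ (d - 1) * v $ i - v $ (d - 1) * p $ i else v $ (d - 1))"
  define L2 where "L2 = (\<lambda>i. if i < d then v $ i else 0)"
  have dot: "nrm h \<bullet> x = (\<Sum>i<d. nrm h $ i * x $ i)" if "x \<in> carrier_vec d" for h x
    using that by (auto simp: scalar_prod_def atLeast0LessThan)
  have sgn_quotient: "sgn (x / y) = sgn x * sgn y" for x y :: real
    unfolding sgn_divide by (simp add: sgn_if)
  show ?thesis
  proof (rule that[of L1 L2])
    fix h assume h: "h \<in> H - T"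
    obtain r where r: "\<Inter>(insert h T) = {r}" "r \<in> carrier_vec d" "\<And>g. g \<in> insert h T \<Longrightarrow> nrm g \<bullet> r = off g"
        "vertex_sign d (insert h T) = sgn (r $ (d - 1))"
      using vertex_ex[OF ins[OF h]] by metis
    \<comment> \<open>If \<open>h\<close> were parallel to the line, translating \<open>r\<close> by
      \<open>v\<close> would give a second common point of \<open>insert h T\<close>.\<close>
    have nz: "nrm h \<bullet> v \<noteq> 0"
    proof
      assume "nrm h \<bullet> v = 0"
      then have "nrm g \<bullet> (r + 1 \<cdot>\<^sub>v v) = off g" if "g \<in> insert h T" for g
        using that line[of g r 1] r nrm_v T h by auto
      then have "r + 1 \<cdot>\<^sub>v v = r"
        using r(2) v by (intro vertex_unique[OF ins[OF h] r(1)]) auto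
      then have "(r + v) $ i = r $ i" for i by simp
      then have "v $ i = 0" if "i < d" for i
        using that r(2) v by (metis add_cancel_left_right carrier_vecD index_add_vec(1))
      then have "q = p" using p q by (auto simp: v_def)
      then show False using \<open>p \<noteq> q\<close> by simp
    qed
    define s where "s = (off h - nrm h \<bullet> p) / (nrm h \<bullet> v)"
    have "nrm g \<bullet> (p + s \<cdot>\<^sub>v v) = off g" if "g \<in> insert h T" for g
      using that line[of g p s] nrm_v p(2,3) T h nz by (auto simp: s_def)
    then have "p + s \<cdot>\<^sub>v v = r"
      using p(2) v by (intro vertex_unique[OF ins[OF h] r(1)]) auto
    then have "r $ (d - 1) = p $ (d - 1) + s * v $ (d - 1)"
      using p(2) v dim by auto
    also have "\<dots> = (p $ (d - 1) * (nrm h \<bullet> v) + (off h - nrm h \<bullet> p) * v $ (d - 1)) / (nrm h \<bullet> v)"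
      using nz by (simp add: s_def field_simps)
    also have "p $ (d - 1) * (nrm h \<bullet> v) + (off h - nrm h \<bullet> p) * v $ (d - 1)
        = (\<Sum>i<Suc d. L1 i * coords h i)"
      by (simp add: dot[OF v] dot[OF p(2)] L1_def coords_def algebra_simps sum_subtractf sum_distrib_left)
    also have "nrm h \<bullet> v = (\<Sum>i<Suc d. L2 i * coords h i)"
      by (simp add: dot[OF v] L2_def coords_def mult.commute)
    finally show "vertex_sign d (insert h T)
       = sgn (\<Sum>i<Suc d. L1 i * coords h i) * sgn (\<Sum>i<Suc d. L2 i * coords h i)"
      unfolding r(4) by (simp only: sgn_quotient)
  qed
qed

text \<open>Both hyperplanes lie in a common \<open>d\<close>-subset and so pass through its vertex
  \<open>p\<close>; each is then the level set of the last coordinate through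
  \<open>p\<close>.\<close>

lemma one_flat_hyperplane:
  assumes h: "h1 \<in> H" "h2 \<in> H" "\<And>j. j < d - 1 \<Longrightarrow> nrm h1 $ j = 0" "\<And>j. j < d - 1 \<Longrightarrow> nrm h2 $ j = 0"
  shows "h1 = h2"
proof (rule ccontr)
  assume ne: "h1 \<noteq> h2"
  obtain S where S: "{h1, h2} \<subseteq> S" "S \<subseteq> H" "card S = d"
    using exists_subset_between[of "{h1, h2}" d H] h ne fin dim card_H by auto
  obtain p where p: "\<Inter>S = {p}" "p \<in> carrier_vec d" "\<And>h. h \<in> S \<Longrightarrow> nrm h \<bullet> p = off h"
    using vertex_ex[OF S(2,3)] by metis
  have flat: "h = {x \<in> carrier_vec d. x $ (d - 1) = p $ (d - 1)}"
    if h: "h \<in> S" "\<And>j. j < d - 1 \<Longrightarrow> nrm h $ j = 0" for h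
  proof -
    have hH: "h \<in> H" using h S by blast
    have dot: "nrm h \<bullet> x = nrm h $ (d - 1) * x $ (d - 1)" if "x \<in> carrier_vec d" for x
    proof -
      obtain e where "d = Suc e" using dim by (cases d) auto
      then show ?thesis using that h(2) by (auto simp: scalar_prod_def)
    qed
    have "nrm h $ (d - 1) \<noteq> 0"
    proof
      assume 0: "nrm h $ (d - 1) = 0"
      have "nrm h $ j = 0" if "j < d" for j
        using h(2)[of j] 0 that by (cases "j = d - 1") auto
      then show False using nrm[OF hH] by auto
    qed
    then have "x \<in> h \<longleftrightarrow> x \<in> carrier_vec d \<and> x $ (d - 1) = p $ (d - 1)" for x
      using mem_iff[OF hH, of x] p(3)[OF h(1)] dot[OF p(2)] dot[of x] by (metis mult_cancel_left)
    then show ?thesis by blast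
  qed
  show False using flat[of h1] flat[of h2] h(3,4) S(1) ne by auto
qed

end

text \<open>Each \<open>T\<close> contributes two forms in \<open>d + 1\<close> variables, the same
  for every further hyperplane, and their sign vector determines the pattern of vertex signs through
  the products in \<open>F\<close>. At most \<open>2 * card G ^ (d - 1)\<close> forms occur, whence
  the 4 in the bound.\<close>

lemma (in arrangement) card_sign_classes:
  assumes "G \<subseteq> H" "R \<subseteq> H - G"
  shows "card ((\<lambda>x. restrict (\<lambda>T. vertex_sign d (insert x T)) {T. T \<subseteq> G \<and> card T = d - 1}) ` R)
    \<le> (4 * card G ^ (d - 1) + 1) ^ Suc d"
proof -
  define \<T> where "\<T> = {T. T \<subseteq> G \<and> card T = d - 1}"
  have finG: "finite G" using assms(1) fin by (rule finite_subset)
  then have fin\<T>: "finite \<T>" by (simp add: \<T>_def)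
  have card\<T>: "card \<T> \<le> card G ^ (d - 1)"
  proof -
    have "card \<T> = card G choose (d - 1)"
      unfolding \<T>_def by (rule n_subsets[OF finG])
    then show ?thesis
      by (cases "d - 1 \<le> card G") (simp_all add: binomial_le_pow binomial_eq_0)
  qed
  have "\<exists>L1 L2. \<forall>h\<in>H - T. vertex_sign d (insert h T)
       = sgn (\<Sum>i<Suc d. L1 i * coords h i) * sgn (\<Sum>i<Suc d. L2 i * coords h i)"
    if "T \<in> \<T>" for T
  proof -
    have "T \<subseteq> H" "card T = d - 1" using that assms(1) by (auto simp: \<T>_def)
    from vertex_sign_linear[OF this] show ?thesis by metis
  qed
  then obtain L1 L2 where L: "\<And>T h. T \<in> \<T> \<Longrightarrow> h \<in> H - T \<Longrightarrow> vertex_sign d (insert h T)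
       = sgn (\<Sum>i<Suc d. L1 T i * coords h i) * sgn (\<Sum>i<Suc d. L2 T i * coords h i)"
    by metis
  define A where "A = \<T> \<times> (UNIV :: bool set)"
  define L where "L = (\<lambda>(T, b). if b then L1 T else L2 T)"
  define F where "F = (\<lambda>v. restrict (\<lambda>T. v (T, True) * v (T, False) :: real) \<T>)"
  have finA: "finite A" using fin\<T> by (simp add: A_def)
  have "restrict (\<lambda>T. vertex_sign d (insert x T)) \<T>
      = F (restrict (\<lambda>a. sgn (\<Sum>i\<in>{..<Suc d}. L a i * coords x i)) A)" if "x \<in> R" for x
  proof -
    have "x \<in> H - T" if "T \<in> \<T>" for T
      using that \<open>x \<in> R\<close> assms(2) by (auto simp: \<T>_def)
    then show ?thesis unfolding F_def by (intro restrict_ext) (simp add: L A_def L_def)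
  qed
  then have "(\<lambda>x. restrict (\<lambda>T. vertex_sign d (insert x T)) \<T>) ` R
      \<subseteq> F ` sign_vectors A {..<Suc d} L"
    unfolding sign_vectors_def by blast
  then have "card ((\<lambda>x. restrict (\<lambda>T. vertex_sign d (insert x T)) \<T>) ` R)
      \<le> card (F ` sign_vectors A {..<Suc d} L)"
    by (intro card_mono finite_imageI finite_sign_vectors finA)
  also have "\<dots> \<le> card (sign_vectors A {..<Suc d} L)"
    by (intro card_image_le finite_sign_vectors finA)
  also have "\<dots> \<le> (2 * card A + 1) ^ card {..<Suc d}"
    by (intro card_sign_vectors finA) simp
  also have "\<dots> \<le> (4 * card G ^ (d - 1) + 1) ^ Suc d"
    using card\<T> unfolding A_def card_cartesian_product card_lessThan
    by (intro power_mono) auto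
  finally show ?thesis unfolding \<T>_def .
qed

section \<open>Slicing: traces on one hyperplane as an arrangement of lower dimension\<close>

text \<open>
  The chart solves the equation for the coordinate \<open>j\<close>; since \<open>j < d - 1\<close>, deleting that
  coordinate keeps the last coordinate in last place.
\<close>

lemma hyperplane_chart:
  fixes a :: "real vec"
  assumes a: "a \<in> carrier_vec d" and j: "j < d - 1" "a $ j \<noteq> 0"
  obtains \<phi> :: "real vec \<Rightarrow> real vec"
  where "bij_betw \<phi> (carrier_vec (d - 1)) {x \<in> carrier_vec d. a \<bullet> x = b}"
    and "\<And>y. \<phi> y $ (d - 1) = y $ (d - 2)"
    and "\<And>a'. \<exists>c\<in>carrier_vec (d - 1). \<exists>e. \<forall>y\<in>carrier_vec (d - 1). a' \<bullet> \<phi> y = c \<bullet> y + e"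
proof -
  define e where "e = d - 1"
  have d: "d = Suc e" using j(1) by (simp add: e_def)
  \<comment> \<open>\<open>\<tau>\<close> enumerates the indices other than \<open>j\<close>.
    \<open>\<phi>\<close> inserts the coordinate \<open>j\<close> that the equation dictates, and
    its inverse \<open>\<psi>\<close> deletes it.\<close>
  define \<tau> where "\<tau> = (\<lambda>i. if i < j then i else Suc i)"
  define \<phi> where "\<phi> = (\<lambda>y. vec d (\<lambda>l. if l = j then (b - (\<Sum>i<e. a $ \<tau> i * y $ i)) / a $ j
      else if l < j then y $ l else y $ (l - 1)))"
  define \<psi> where "\<psi> = (\<lambda>x::real vec. vec e (\<lambda>i. x $ \<tau> i))"
  have je: "j < e" using j(1) by (simp add: e_def)
  have \<tau>_surj: "\<exists>i<e. l = \<tau> i" if "l < d" "l \<noteq> j" for l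
    using that je d by (intro exI[of _ "if l < j then l else l - 1"]) (auto simp: \<tau>_def)
  have \<tau>: "\<tau> i < d" "\<tau> i \<noteq> j" if "i < e" for i
    using that d by (auto simp: \<tau>_def)
  have "inj_on \<tau> {..<e}" by (auto simp: inj_on_def \<tau>_def split: if_splits)
  moreover have "\<tau> ` {..<e} = {..<d} - {j}" using \<tau>_surj \<tau> by auto
  ultimately have "bij_betw \<tau> {..<e} ({..<d} - {j})" by (simp add: bij_betw_def)
  note * = sum.reindex_bij_betw[OF this]
  have sum_\<tau>: "(\<Sum>l<d. f l) = f j + (\<Sum>i<e. f (\<tau> i))" for f :: "nat \<Rightarrow> real"
  proof -
    have "(\<Sum>l<d. f l) = f j + sum f ({..<d} - {j})"
      using je d by (intro sum.remove) auto
    then show ?thesis by (simp add: *)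
  qed
  have \<phi>_\<tau>: "\<phi> y $ \<tau> i = y $ i" if "i < e" for y i
    using \<tau>[OF that] by (cases "i < j") (simp_all add: \<phi>_def \<tau>_def)
  have \<phi>_j: "\<phi> y $ j = (b - (\<Sum>i<e. a $ \<tau> i * y $ i)) / a $ j" for y
    using je d by (simp add: \<phi>_def)
  have \<phi>_car: "\<phi> y \<in> carrier_vec d" for y by (simp add: \<phi>_def)
  have dot: "a' \<bullet> x = a' $ j * x $ j + (\<Sum>i<e. a' $ \<tau> i * x $ \<tau> i)" if "x \<in> carrier_vec d" for a' x :: "real vec"
    using that by (simp add: scalar_prod_def atLeast0LessThan sum_\<tau>)
  have dot_\<phi>: "a' \<bullet> \<phi> y = a' $ j * ((b - (\<Sum>i<e. a $ \<tau> i * y $ i)) / a $ j) + (\<Sum>i<e. a' $ \<tau> i * y $ i)" for a' y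
    by (simp add: dot[OF \<phi>_car] \<phi>_j \<phi>_\<tau>)
  show ?thesis
  proof (rule that[of \<phi>])
    show "bij_betw \<phi> (carrier_vec (d - 1)) {x \<in> carrier_vec d. a \<bullet> x = b}"
    proof (rule bij_betw_byWitness[where f' = \<psi>])
      show "\<forall>y\<in>carrier_vec (d - 1). \<psi> (\<phi> y) = y"
        by (auto simp: \<psi>_def \<phi>_\<tau> d)
      show "\<forall>x\<in>{x \<in> carrier_vec d. a \<bullet> x = b}. \<phi> (\<psi> x) = x"
      proof
        fix x assume x: "x \<in> {x \<in> carrier_vec d. a \<bullet> x = b}"
        then have xd: "dim_vec x = d" by (auto dest: carrier_vecD)
        have \<psi>: "\<psi> x $ i = x $ \<tau> i" if "i < e" for i using that by (simp add: \<psi>_def)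
        show "\<phi> (\<psi> x) = x"
        proof (rule eq_vecI)
          fix l assume "l < dim_vec x"
          then have l: "l < d" unfolding xd .
          show "\<phi> (\<psi> x) $ l = x $ l"
          proof (cases "l = j")
            case True
            have "b - (\<Sum>i<e. a $ \<tau> i * \<psi> x $ i) = a $ j * x $ j"
              using x by (auto simp: dot \<psi>)
            then show ?thesis using True j(2) by (simp add: \<phi>_j)
          next
            case False
            then obtain i where "i < e" "l = \<tau> i" using \<tau>_surj l by blast
            then show ?thesis by (simp add: \<phi>_\<tau> \<psi>)
          qed
        qed (simp add: \<phi>_def xd)
      qed
      show "\<phi> ` carrier_vec (d - 1) \<subseteq> {x \<in> carrier_vec d. a \<bullet> x = b}"
        using \<phi>_car j(2) by (auto simp: dot_\<phi>)
      show "\<psi> ` {x \<in> carrier_vec d. a \<bullet> x = b} \<subseteq> carrier_vec (d - 1)"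
        by (auto simp: \<psi>_def e_def)
    qed
    show "\<phi> y $ (d - 1) = y $ (d - 2)" for y
      using je d by (simp add: \<phi>_def)
    show "\<exists>c\<in>carrier_vec (d - 1). \<exists>k. \<forall>y\<in>carrier_vec (d - 1). a' \<bullet> \<phi> y = c \<bullet> y + k" for a'
    proof (intro bexI exI ballI)
      fix y :: "real vec" assume "y \<in> carrier_vec (d - 1)"
      then have "vec e (\<lambda>i. a' $ \<tau> i - a' $ j * a $ \<tau> i / a $ j) \<bullet> y
          = (\<Sum>i<e. (a' $ \<tau> i - a' $ j * a $ \<tau> i / a $ j) * y $ i)"
        by (simp add: scalar_prod_def atLeast0LessThan d)
      also have "\<dots> = (\<Sum>i<e. a' $ \<tau> i * y $ i) - a' $ j * ((\<Sum>i<e. a $ \<tau> i * y $ i) / a $ j)"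
        by (simp add: left_diff_distrib sum_subtractf sum_distrib_left sum_divide_distrib mult.assoc)
      finally show "a' \<bullet> \<phi> y = vec e (\<lambda>i. a' $ \<tau> i - a' $ j * a $ \<tau> i / a $ j) \<bullet> y + a' $ j * (b / a $ j)"
        by (simp add: dot_\<phi> diff_divide_distrib right_diff_distrib)
    qed (simp add: e_def)
  qed
qed

text \<open>The chart is a bijection onto \<open>h0\<close>, so the traces of \<open>S\<close> meet
  exactly where \<open>S\<close> meets \<open>h0\<close>; it keeps the last coordinate, so it keeps
  the sign.\<close>

lemma (in arrangement) slice_vertices:
  assumes chart: "bij_betw \<phi> (carrier_vec (d - 1)) h0"
      "\<And>y. \<phi> y $ (d - 1) = y $ (d - 2)"
    and h0: "h0 \<in> H" and S: "S \<subseteq> H - {h0}" "card S = d - 1"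
  obtains y where "(\<Inter>h\<in>S. {y \<in> carrier_vec (d - 1). \<phi> y \<in> h}) = {y}" "\<Inter>(insert h0 S) = {\<phi> y}"
    "vertex_sign d (insert h0 S) = sgn (y $ (d - 2))"
proof -
  have finS: "finite S" using S(1) fin by (meson finite_Diff finite_subset)
  \<comment> \<open>The intersection of an empty family would be the whole type, not the
    carrier.\<close>
  have ne: "S \<noteq> {}" using S(2) dim by auto
  have "h0 \<notin> S" using S(1) by blast
  then have "card (insert h0 S) = d" "insert h0 S \<subseteq> H"
    using S finS h0 dim by auto
  then obtain p where p: "\<Inter>(insert h0 S) = {p}" "vertex_sign d (insert h0 S) = sgn (p $ (d - 1))"
    using vertex_ex by metis
  then have "p \<in> h0" by blast
  then obtain y where y: "y \<in> carrier_vec (d - 1)" "p = \<phi> y"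
    using chart(1) by (metis bij_betw_def imageE)
  have unique: "z = y" if z: "z \<in> carrier_vec (d - 1)" "\<And>h. h \<in> S \<Longrightarrow> \<phi> z \<in> h" for z
  proof -
    have "\<phi> z \<in> h0" using chart(1) z(1) by (rule bij_betw_apply)
    then have "\<phi> z \<in> \<Inter>(insert h0 S)" using z(2) by simp
    then have "\<phi> z = \<phi> y" unfolding p(1) y(2) by simp
    then show ?thesis using chart(1) z(1) y(1) by (meson bij_betw_def inj_on_def)
  qed
  have \<phi>y: "\<phi> y \<in> h" if "h \<in> S" for h
    using p(1) y(2) that by blast
  have "(\<Inter>h\<in>S. {y \<in> carrier_vec (d - 1). \<phi> y \<in> h}) = {y}"
  proof (intro subset_antisym subsetI)
    fix z assume z: "z \<in> (\<Inter>h\<in>S. {y \<in> carrier_vec (d - 1). \<phi> y \<in> h})"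
    obtain g where "g \<in> S" using ne by blast
    then have "z \<in> carrier_vec (d - 1)" using z by blast
    moreover have "\<phi> z \<in> h" if "h \<in> S" for h using z that by blast
    ultimately show "z \<in> {y}" using unique by blast
  next
    fix z assume "z \<in> {y}"
    then show "z \<in> (\<Inter>h\<in>S. {y \<in> carrier_vec (d - 1). \<phi> y \<in> h})"
      using y(1) \<phi>y by simp
  qed
  moreover have "\<Inter>(insert h0 S) = {\<phi> y}" unfolding p(1) y(2) ..
  moreover have "vertex_sign d (insert h0 S) = sgn (y $ (d - 2))" unfolding p(2) y(2) chart(2) ..
  ultimately show ?thesis by (rule that)
qed

text \<open>The traces \<open>sl h\<close> satisfy the premises of \<open>OSH_property\<close> in
  dimension \<open>d - 1\<close>: they are distinct hyperplanes in general position. The one-sided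
  family found there is pulled back along \<open>sl\<close>.\<close>

lemma (in arrangement) slice_one_sided:
  assumes d3: "d \<ge> 3" and h0: "h0 \<in> H" "j < d - 1" "nrm h0 $ j \<noteq> 0"
    and K: "K \<subseteq> H - {h0}" and osh: "OSH_property (d - 1) m (card K)"
  shows "\<exists>K'\<subseteq>K. card K' = m \<and> (\<exists>\<epsilon>\<in>{1, -1}. \<forall>S\<subseteq>K'. card S = d - 1 \<longrightarrow> vertex_sign d (insert h0 S) = \<epsilon>)"
proof -
  obtain \<phi> where chart_nrm: "bij_betw \<phi> (carrier_vec (d - 1)) {x \<in> carrier_vec d. nrm h0 \<bullet> x = off h0}"
      and last: "\<And>y. \<phi> y $ (d - 1) = y $ (d - 2)"
      and affine: "\<And>a'. \<exists>c\<in>carrier_vec (d - 1). \<exists>e. \<forall>y\<in>carrier_vec (d - 1). a' \<bullet> \<phi> y = c \<bullet> y + e"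
    by (rule hyperplane_chart[OF nrm(1)[OF h0(1)] h0(2,3), of "off h0"]) (rule that)
  have chart: "bij_betw \<phi> (carrier_vec (d - 1)) h0"
    by (subst hyp_eq[OF h0(1)]) (rule chart_nrm)
  define sl where "sl = (\<lambda>h. {y \<in> carrier_vec (d - 1). \<phi> y \<in> h})"
  have finK: "finite K" using K fin by (meson finite_Diff finite_subset)
  have pull: "\<exists>y\<in>carrier_vec (d - 1). \<phi> y = x" if "x \<in> h0" for x
    using chart that by (metis bij_betw_def imageE)
  have \<phi>_h0: "\<phi> y \<in> h0" if "y \<in> carrier_vec (d - 1)" for y
    using chart that by (rule bij_betw_apply)
  note two = two_hyperplanes_not_subset[OF gp fin dim card_H]
  have KH: "h \<in> H" "h \<noteq> h0" if "h \<in> K" for h using K that by auto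
  have inj: "inj_on sl K"
  proof (rule inj_onI, rule ccontr)
    fix h1 h2 assume h: "h1 \<in> K" "h2 \<in> K" "sl h1 = sl h2" "h1 \<noteq> h2"
    have "h0 \<inter> h1 \<subseteq> h2"
    proof
      fix x assume x: "x \<in> h0 \<inter> h1"
      then obtain y where y: "y \<in> carrier_vec (d - 1)" "\<phi> y = x" using pull by blast
      then have "y \<in> sl h1" using x by (simp add: sl_def)
      then have "y \<in> sl h2" unfolding h(3) .
      then show "x \<in> h2" using y(2) by (simp add: sl_def)
    qed
    then show False using two[of h0 h1 h2] h0(1) KH[OF h(1)] KH[OF h(2)] h(4) by blast
  qed
  have vert: "\<exists>y. \<Inter>(sl ` S) = {y} \<and> \<Inter>(insert h0 S) = {\<phi> y} \<and> vertex_sign d (insert h0 S) = sgn (y $ (d - 2))"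
    if S: "S \<subseteq> K" "card S = d - 1" for S
  proof -
    have "S \<subseteq> H - {h0}" using S(1) K by blast
    then obtain y where "(\<Inter>h\<in>S. {y \<in> carrier_vec (d - 1). \<phi> y \<in> h}) = {y}" "\<Inter>(insert h0 S) = {\<phi> y}"
        "vertex_sign d (insert h0 S) = sgn (y $ (d - 2))"
      by (rule slice_vertices[OF chart last h0(1) _ S(2)]) (rule that)
    then show ?thesis unfolding sl_def by (intro exI conjI)
  qed
  have hyp: "hyperplane (d - 1) (sl h)" if h: "h \<in> K" for h
  proof -
    note hH = KH[OF h]
    obtain c e where c: "c \<in> carrier_vec (d - 1)"
      and ce: "\<And>y. y \<in> carrier_vec (d - 1) \<Longrightarrow> nrm h \<bullet> \<phi> y = c \<bullet> y + e"
      using affine[of "nrm h"] by blast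
    have mem: "\<phi> y \<in> h \<longleftrightarrow> c \<bullet> y = off h - e" if y: "y \<in> carrier_vec (d - 1)" for y
    proof -
      have "\<phi> y \<in> carrier_vec d" using \<phi>_h0[OF y] mem_iff[OF h0(1)] by blast
      then show ?thesis using mem_iff[OF hH(1)] ce[OF y] by auto
    qed
    \<comment> \<open>With \<open>c = 0\<close> the trace would be empty or everything. The first
      fails because \<open>h0\<close> and \<open>h\<close> share a vertex, the second because
      \<open>h0 \<inter> g\<close> is not contained in \<open>h\<close> for a third member
      \<open>g\<close>.\<close>
    have "c \<noteq> 0\<^sub>v (d - 1)"
    proof
      assume c0: "c = 0\<^sub>v (d - 1)"
      obtain S where S: "{h0, h} \<subseteq> S" "S \<subseteq> H" "card S = d"
        using exists_subset_between[of "{h0, h}" d H] h0(1) hH fin dim card_H by auto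
      obtain p where "\<Inter>S = {p}" using vertex_ex[OF S(2,3)] by metis
      then have "p \<in> h0" "p \<in> h" using S(1) by auto
      then obtain y where y: "y \<in> carrier_vec (d - 1)" "\<phi> y \<in> h" using pull by blast
      have "card {h0, h} < card H"
        using hH(2) dim card_H by simp
      then have "\<not> H \<subseteq> {h0, h}" using card_mono[of "{h0, h}" H] by auto
      then obtain g where "g \<in> H" "g \<noteq> h0" "g \<noteq> h" by blast
      then obtain x where "x \<in> h0" "x \<notin> h" using two[of h0 g h] h0(1) hH by blast
      then obtain z where z: "z \<in> carrier_vec (d - 1)" "\<phi> z \<notin> h" using pull by blast
      show False using mem[OF y(1)] mem[OF z(1)] y z c0 by simp
    qed
    moreover have "sl h = {y \<in> carrier_vec (d - 1). c \<bullet> y = off h - e}"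
      unfolding sl_def using mem by blast
    ultimately show ?thesis unfolding hyperplane_def using c by blast
  qed
  have pre: "\<exists>S\<subseteq>K. S' = sl ` S \<and> card S = d - 1" if S': "S' \<subseteq> sl ` K" "card S' = d - 1" for S'
  proof -
    obtain S where S: "S \<subseteq> K" "S' = sl ` S" using S'(1) by (meson subset_imageE)
    have "card S' = card S" unfolding S(2) by (rule card_image[OF inj_on_subset[OF inj S(1)]])
    then show ?thesis using S S'(2) by auto
  qed
  have "general_position (d - 1) (sl ` K)"
    unfolding general_position_def
  proof (intro conjI allI impI)
    fix S' assume "S' \<subseteq> sl ` K \<and> card S' = d - 1"
    then obtain S where "S \<subseteq> K" "S' = sl ` S" "card S = d - 1" using pre by metis
    then show "is_singleton (\<Inter>S')" using vert[of S] unfolding is_singleton_def by auto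
  next
    show "inj_on Inter {S. S \<subseteq> sl ` K \<and> card S = d - 1}"
    proof (rule inj_onI)
      fix S1' S2' assume S': "S1' \<in> {S. S \<subseteq> sl ` K \<and> card S = d - 1}"
        "S2' \<in> {S. S \<subseteq> sl ` K \<and> card S = d - 1}" "\<Inter>S1' = \<Inter>S2'"
      obtain S1 where S1: "S1 \<subseteq> K" "S1' = sl ` S1" "card S1 = d - 1" using pre[of S1'] S'(1) by blast
      obtain S2 where S2: "S2 \<subseteq> K" "S2' = sl ` S2" "card S2 = d - 1" using pre[of S2'] S'(2) by blast
      obtain y1 where y1: "\<Inter>(sl ` S1) = {y1}" "\<Inter>(insert h0 S1) = {\<phi> y1}"
        using vert[OF S1(1,3)] by (elim exE conjE) (rule that, assumption+)
      obtain y2 where y2: "\<Inter>(sl ` S2) = {y2}" "\<Inter>(insert h0 S2) = {\<phi> y2}"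
        using vert[OF S2(1,3)] by (elim exE conjE) (rule that, assumption+)
      have "y1 = y2" using S'(3) unfolding S1(2) S2(2) y1(1) y2(1) by simp
      then have eq: "\<Inter>(insert h0 S1) = \<Inter>(insert h0 S2)" unfolding y1(2) y2(2) by simp
      have ins: "insert h0 S \<subseteq> H \<and> card (insert h0 S) = d \<and> h0 \<notin> S" if "S \<subseteq> K" "card S = d - 1" for S
      proof -
        have "h0 \<notin> S" "finite S" using that K finK finite_subset by auto
        then show ?thesis using that K h0(1) dim by auto
      qed
      \<comment> \<open>Distinctness of vertices is inherited from dimension \<open>d\<close> by
        adding \<open>h0\<close> to both sets.\<close>
      have "insert h0 S1 = insert h0 S2"
        using vertices_distinct[OF _ _ _ _ eq] ins[OF S1(1,3)] ins[OF S2(1,3)] by blast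
      moreover have "h0 \<notin> S1" "h0 \<notin> S2" using S1(1) S2(1) K by blast+
      ultimately have "S1 = S2" by (simp add: insert_ident)
      then show "S1' = S2'" using S1 S2 by simp
    qed
  qed
  then have "\<exists>L. L \<subseteq> sl ` K \<and> card L = m \<and> one_sided (d - 1) L"
    using osh[unfolded OSH_property_def, rule_format, of "sl ` K"] finK hyp card_image[OF inj] by simp
  then obtain L where L: "L \<subseteq> sl ` K" "card L = m" "one_sided (d - 1) L" by blast
  obtain K' where K': "K' \<subseteq> K" "L = sl ` K'" using L(1) by (meson subset_imageE)
  have inj': "inj_on sl K'" using inj K'(1) by (rule inj_on_subset)
  have cardK': "card K' = m" using card_image[OF inj'] K'(2) L(2) by simp
  have vtx: "\<exists>y\<in>vertices (d - 1) L. vertex_sign d (insert h0 S) = sgn (y $ (d - 1 - 1))"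
    if S: "S \<subseteq> K'" "card S = d - 1" for S
  proof -
    obtain y where y: "\<Inter>(sl ` S) = {y}" "vertex_sign d (insert h0 S) = sgn (y $ (d - 2))"
      using vert[OF order_trans[OF S(1) K'(1)] S(2)] by (elim exE conjE) (rule that, assumption+)
    have "card (sl ` S) = d - 1" using card_image[OF inj_on_subset[OF inj' S(1)]] S(2) by simp
    moreover have "sl ` S \<subseteq> L" using S(1) K'(2) by blast
    ultimately have "y \<in> vertices (d - 1) L"
      unfolding vertices_def mem_Collect_eq using y(1) by (intro exI conjI)
    then show ?thesis using y(2) by (intro bexI[of _ y]) (simp_all add: numeral_2_eq_2)
  qed
  have "(\<forall>p\<in>vertices (d - 1) L. p $ (d - 1 - 1) > 0) \<or> (\<forall>p\<in>vertices (d - 1) L. p $ (d - 1 - 1) < 0)"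
    using L(3) unfolding one_sided_def .
  then have "\<exists>\<epsilon>\<in>{1, -1}. \<forall>S\<subseteq>K'. card S = d - 1 \<longrightarrow> vertex_sign d (insert h0 S) = \<epsilon>"
  proof
    assume "\<forall>p\<in>vertices (d - 1) L. p $ (d - 1 - 1) > 0"
    then have "\<forall>S\<subseteq>K'. card S = d - 1 \<longrightarrow> vertex_sign d (insert h0 S) = 1"
      using vtx by (metis sgn_pos)
    then show ?thesis by blast
  next
    assume "\<forall>p\<in>vertices (d - 1) L. p $ (d - 1 - 1) < 0"
    then have "\<forall>S\<subseteq>K'. card S = d - 1 \<longrightarrow> vertex_sign d (insert h0 S) = -1"
      using vtx by (metis sgn_neg)
    then show ?thesis by blast
  qed
  then show ?thesis using K'(1) cardK' by blast
qed

section \<open>The recursive step from dimension \<open>d - 1\<close> to \<open>d\<close>\<close>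

text \<open>The greedy argument, with \<open>vertex_sign\<close> as colouring, gives
  \<open>G\<close> and \<open>x\<close>; slicing along \<open>x\<close> gives \<open>n - 1\<close>
  members of \<open>G\<close>, and \<open>x\<close> is the \<open>n\<close>-th.\<close>

lemma (in arrangement) one_sided_subset_exists:
  assumes d3: "d \<ge> 3" and n: "n \<ge> 1" and osh: "OSH_property (d - 1) (n - 1) M"
    and big: "((4 * M ^ (d - 1) + 1) ^ Suc d + 1) ^ M + 1 \<le> card H"
  shows "\<exists>K\<subseteq>H. card K = n \<and> one_sided d K"
proof -
  define Q where "Q = (4 * M ^ (d - 1) + 1) ^ Suc d"
  \<comment> \<open>Only \<open>x\<close> must admit a chart, but it is not known in advance, so a
    hyperplane parallel to \<open>x_d = 0\<close> is discarded at the start. The final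
    \<open>+ 1\<close> in \<open>big\<close> pays for it.\<close>
  define H' where "H' = {h \<in> H. \<exists>j<d - 1. nrm h $ j \<noteq> 0}"
  have finH': "finite H'" using fin by (simp add: H'_def)
  have "card (H - H') \<le> 1"
  proof -
    have "h1 = h2" if "h1 \<in> H - H'" "h2 \<in> H - H'" for h1 h2
      using that one_flat_hyperplane[of h1 h2] by (auto simp: H'_def)
    then show ?thesis using fin by (simp add: card_le_Suc0_iff_eq)
  qed
  moreover have "card (H - H') = card H - card H'"
    by (rule card_Diff_subset[OF finH']) (auto simp: H'_def)
  ultimately have cardH': "(Q + 1) ^ M \<le> card H'" using big by (simp add: Q_def)
  have "\<exists>G x. G \<subseteq> H' \<and> card G = M \<and> x \<in> H' - G \<and> (\<forall>S\<subseteq>G. card S = Suc (d - 1) \<longrightarrow>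
      (\<exists>s\<in>S. vertex_sign d S = vertex_sign d (insert x (S - {s}))))"
  proof (rule end_homogeneous_exists[OF finH' cardH'])
    show "d - 1 > 0" "Q > 0" using dim by (auto simp: Q_def)
    fix G R assume G: "G \<subseteq> H'" "card G \<le> M" "R \<subseteq> H' - G"
    have "card ((\<lambda>x. restrict (\<lambda>T. vertex_sign d (insert x T)) {T. T \<subseteq> G \<and> card T = d - 1}) ` R)
      \<le> (4 * card G ^ (d - 1) + 1) ^ Suc d"
      using G by (intro card_sign_classes) (auto simp: H'_def)
    also have "\<dots> \<le> Q"
      unfolding Q_def using G(2) by (intro power_mono add_mono mult_left_mono) auto
    finally show "card ((\<lambda>x. restrict (\<lambda>T. vertex_sign d (insert x T)) {T. T \<subseteq> G \<and> card T = d - 1}) ` R) \<le> Q" .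
  qed
  then obtain G x where G: "G \<subseteq> H'" "card G = M" and x: "x \<in> H'" "x \<notin> G"
    and hom: "\<And>S. S \<subseteq> G \<Longrightarrow> card S = Suc (d - 1) \<Longrightarrow>
        \<exists>s\<in>S. vertex_sign d S = vertex_sign d (insert x (S - {s}))"
    by blast
  obtain j where j: "j < d - 1" "nrm x $ j \<noteq> 0" "x \<in> H" using x(1) by (auto simp: H'_def)
  have GH: "G \<subseteq> H - {x}" using G(1) x(2) by (auto simp: H'_def)
  have "OSH_property (d - 1) (n - 1) (card G)" using osh G(2) by simp
  from slice_one_sided[OF d3 j(3,1,2) GH this] obtain K \<epsilon> where K: "K \<subseteq> G" "card K = n - 1"
    and \<epsilon>: "\<epsilon> = 1 \<or> \<epsilon> = -1" "\<And>S. S \<subseteq> K \<Longrightarrow> card S = d - 1 \<Longrightarrow> vertex_sign d (insert x S) = \<epsilon>"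
    by blast
  have finK: "finite K" using K(1) G(1) finH' by (meson finite_subset)
  have xK: "x \<notin> K" using x(2) K(1) by blast
  have sign: "sgn (p $ (d - 1)) = \<epsilon>" if p: "p \<in> vertices d (insert x K)" for p
  proof -
    obtain S where S: "S \<subseteq> insert x K" "card S = d" "\<Inter>S = {p}"
      using p unfolding vertices_def mem_Collect_eq by (elim exE conjE) (rule that, assumption+)
    have "vertex_sign d S = \<epsilon>"
    proof (cases "x \<in> S")
      case True
      have "S - {x} \<subseteq> K" "card (S - {x}) = d - 1" using S True by auto
      from \<epsilon>(2)[OF this] show ?thesis unfolding insert_Diff[OF True] .
    next
      case False
      \<comment> \<open>A vertex off \<open>x\<close> has the sign of a vertex on \<open>x\<close>,
        by exchanging \<open>s\<close> for \<open>x\<close>.\<close>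
      then have SK: "S \<subseteq> K" using S(1) by blast
      then obtain s where s: "s \<in> S" "vertex_sign d S = vertex_sign d (insert x (S - {s}))"
        using hom[of S] K(1) S(2) dim by fastforce
      have "S - {s} \<subseteq> K" "card (S - {s}) = d - 1" using S(2) s(1) SK by auto
      from \<epsilon>(2)[OF this] show ?thesis using s(2) by simp
    qed
    then show ?thesis using S(3) by (simp add: vertex_sign_def)
  qed
  have "one_sided d (insert x K)"
    using \<epsilon>(1) unfolding one_sided_def
  proof
    assume "\<epsilon> = 1"
    then show "(\<forall>p\<in>vertices d (insert x K). p $ (d - 1) > 0) \<or> (\<forall>p\<in>vertices d (insert x K). p $ (d - 1) < 0)"
      using sign sgn_1_pos by blast
  next
    assume "\<epsilon> = -1"
    then show "(\<forall>p\<in>vertices d (insert x K). p $ (d - 1) > 0) \<or> (\<forall>p\<in>vertices d (insert x K). p $ (d - 1) < 0)"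
      using sign sgn_1_neg by blast
  qed
  moreover have "card (insert x K) = n" using finK xK K(2) n by simp
  moreover have "insert x K \<subseteq> H" using K(1) GH j(3) by blast
  ultimately show ?thesis by blast
qed

lemma OSH_step:
  assumes d3: "d \<ge> 3" and n: "n \<ge> 1" and osh: "OSH_property (d - 1) (n - 1) M"
    and large: "Suc d \<le> ((4 * M ^ (d - 1) + 1) ^ Suc d + 1) ^ M + 1"
  shows "OSH_property d n (((4 * M ^ (d - 1) + 1) ^ Suc d + 1) ^ M + 1)"
  unfolding OSH_property_def
proof (intro allI impI, elim conjE)
  fix H :: "real vec set set"
  assume H: "finite H" "card H = ((4 * M ^ (d - 1) + 1) ^ Suc d + 1) ^ M + 1"
    "\<forall>h\<in>H. hyperplane d h" "general_position d H"
  then obtain nrm off where eqn: "\<And>h. h \<in> H \<Longrightarrow> nrm h \<in> carrier_vec d \<and> nrm h \<noteq> 0\<^sub>v d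
      \<and> h = {x \<in> carrier_vec d. nrm h \<bullet> x = off h}"
    unfolding hyperplane_def by metis
  interpret arrangement d H nrm off
  proof
    show "2 \<le> d" "Suc d \<le> card H" using d3 H(2) large by simp_all
  qed (use H eqn in blast)+
  show "\<exists>K. K \<subseteq> H \<and> card K = n \<and> one_sided d K"
    using one_sided_subset_exists[OF d3 n osh] H(2) by simp
qed

section \<open>Numerical estimates and the constant\<close>

text \<open>Fewer than two hyperplanes are vacuously in general position and too few to contain
  \<open>n\<close> members. The bound lets constants be absorbed into powers of
  \<open>M\<close>.\<close>

lemma OSH_ge_2:
  assumes d: "d \<ge> 2" and n: "n \<ge> 2"
  shows "OSH d n \<ge> 2"
proof (rule ccontr)
  assume "\<not> ?thesis"
  then have less: "OSH d n < 2" by simp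
  define h where "h = {x \<in> carrier_vec d. unit_vec d 0 \<bullet> x = (0::real)}"
  have hyp: "hyperplane d h"
    unfolding hyperplane_def h_def using d by (intro exI[of _ "unit_vec d 0"] exI[of _ 0]) auto
  define H where "H = (if OSH d n = 0 then {} else {h})"
  have H: "finite H" "card H = OSH d n" "\<forall>h\<in>H. hyperplane d h"
    using less hyp by (auto simp: H_def)
  have "\<not> (S \<subseteq> H \<and> card S = d)" for S
    using card_mono[OF H(1), of S] H(2) less d by auto
  then have "general_position d H"
    unfolding general_position_def inj_on_def by blast
  moreover have "OSH_property d n (OSH d n)" using d by (intro OSH_property_OSH) simp
  ultimately obtain K where "K \<subseteq> H" "card K = n"
    using H unfolding OSH_property_def by blast
  then show False using card_mono[OF H(1), of K] H(2) less n by simp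
qed

text \<open>Since \<open>M \<ge> 2\<close>, the factor 4 costs two powers of \<open>M\<close> and
  each \<open>+ 1\<close> costs one. The last one is outside the \<open>M\<close>-th power, and its
  cost 1 is bounded by \<open>M\<close> in the exponent.\<close>

lemma step_bound:
  fixes M d :: nat
  assumes M: "M \<ge> 2" and d: "d \<ge> 1"
  shows "((4 * M ^ (d - 1) + 1) ^ Suc d + 1) ^ M + 1 \<le> M ^ (((d + 2) * Suc d + 2) * M)"
proof -
  have succ: "a + 1 \<le> M * a" if "a \<ge> 1" for a
    using mult_le_mono1[OF M, of a] that by linarith
  have "4 * M ^ (d - 1) + 1 \<le> M ^ (d + 2)"
  proof -
    have "4 * M ^ (d - 1) \<le> M * M * M ^ (d - 1)"
      using mult_le_mono[OF M M] by (intro mult_right_mono) auto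
    also have "\<dots> = M ^ (d + 1)" using d by (cases d) auto
    finally have "4 * M ^ (d - 1) + 1 \<le> M ^ (d + 1) + 1" by simp
    also have "\<dots> \<le> M * M ^ (d + 1)" using M by (intro succ) simp
    finally show ?thesis by simp
  qed
  then have "(4 * M ^ (d - 1) + 1) ^ Suc d \<le> (M ^ (d + 2)) ^ Suc d"
    by (rule power_mono) simp
  then have "(4 * M ^ (d - 1) + 1) ^ Suc d + 1 \<le> M * M ^ ((d + 2) * Suc d)"
    using succ[of "M ^ ((d + 2) * Suc d)"] M unfolding power_mult by simp
  then have "((4 * M ^ (d - 1) + 1) ^ Suc d + 1) ^ M \<le> (M ^ Suc ((d + 2) * Suc d)) ^ M"
    by (intro power_mono) auto
  then have "((4 * M ^ (d - 1) + 1) ^ Suc d + 1) ^ M + 1 \<le> M ^ (Suc ((d + 2) * Suc d) * M) + 1"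
    unfolding power_mult by simp
  also have "\<dots> \<le> M * M ^ (Suc ((d + 2) * Suc d) * M)" using M by (intro succ) simp
  also have "\<dots> = M ^ Suc (Suc ((d + 2) * Suc d) * M)" by simp
  also have "\<dots> \<le> M ^ (((d + 2) * Suc d + 2) * M)"
    using M by (intro power_increasing) (auto simp: algebra_simps)
  finally show ?thesis .
qed

theorem theorem9:
  fixes d :: nat
  assumes "d \<ge> 3"
  shows "\<exists>C2::real. \<forall>n::nat. n \<ge> 1 \<and> n \<noteq> 2 \<longrightarrow>
    (let M = real (OSH (d - 1) (n - 1))
     in real (OSH d n) \<le> 2 powr (C2 * M * log 2 M))"
proof (intro exI allI impI)
  fix n :: nat
  assume n: "n \<ge> 1 \<and> n \<noteq> 2"
  define c where "c = (d + 2) * Suc d + 2"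
  define M where "M = OSH (d - 1) (n - 1)"
  have "real (OSH d n) \<le> 2 powr (real c * real M * log 2 (real M))"
  \<comment> \<open>For \<open>n = 1\<close> the claim is 1 \<le> 1, as \<open>M = 0\<close>. For
    \<open>n = 2\<close> it would fail: there \<open>M = 1\<close> and the right side is 1, while
    \<open>OSH d 2 = 2\<close>.\<close>
  proof (cases "n = 1")
    case True
    then have "OSH d n = 1" "M = 0" using assms by (simp_all add: OSH_below_dim M_def)
    then show ?thesis by simp
  next
    case False
    have M: "M \<ge> 2" unfolding M_def using assms n False by (intro OSH_ge_2) auto
    have "OSH_property (d - 1) (n - 1) M"
      unfolding M_def using assms by (intro OSH_property_OSH) simp
    \<comment> \<open>An \<open>arrangement\<close> needs at least \<open>d + 1\<close>
      members.\<close>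
    moreover have "Suc d \<le> ((4 * M ^ (d - 1) + 1) ^ Suc d + 1) ^ M + 1"
    proof -
      have "d < 2 ^ d" by (rule less_exp)
      also have "\<dots> \<le> (4 * M ^ (d - 1) + 1) ^ d" using M by (intro power_mono) auto
      also have "\<dots> \<le> (4 * M ^ (d - 1) + 1) ^ Suc d" by (intro power_increasing) auto
      also have "\<dots> \<le> (4 * M ^ (d - 1) + 1) ^ Suc d + 1" by simp
      also have "\<dots> \<le> ((4 * M ^ (d - 1) + 1) ^ Suc d + 1) ^ M"
        using M by (intro self_le_power) auto
      finally show ?thesis by simp
    qed
    ultimately have "OSH_property d n (((4 * M ^ (d - 1) + 1) ^ Suc d + 1) ^ M + 1)"
      using assms n by (intro OSH_step) auto
    then have "OSH d n \<le> ((4 * M ^ (d - 1) + 1) ^ Suc d + 1) ^ M + 1"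
      unfolding OSH_def by (rule Least_le)
    also have "\<dots> \<le> M ^ (c * M)"
      unfolding c_def using M assms by (intro step_bound) auto
    finally have "real (OSH d n) \<le> real M ^ (c * M)"
      by (metis of_nat_le_iff of_nat_power)
    also have "\<dots> = real M powr (real c * real M)"
      using M by (simp flip: powr_realpow)
    also have "\<dots> = (2 powr log 2 (real M)) powr (real c * real M)"
      using M by simp
    also have "\<dots> = 2 powr (real c * real M * log 2 (real M))"
      by (simp add: powr_powr mult.commute)
    finally show ?thesis .
  qed
  then show "let M = real (OSH (d - 1) (n - 1)) in real (OSH d n) \<le> 2 powr (real c * M * log 2 M)"
    by (simp add: M_def Let_def)
qed

end
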